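(* Suppose Assumption 1 (subsystem model) and Assumption 2 (regularizers), both stated in the context, hold. Then every limit point of the iterates $\{\theta^k\}_{k\in\mathbb N}$ generated by the EM++ algorithm (defined in the context) is a stationary point of $\bar{\mathcal L}$.
   Context: **Model.** Let $d,T,n_y,n_z,t_y,n_g\ge 1$ be integers, $\Xi=\{1,\dots,d\}$, and $\mathcal B$ a Euclidean space. The parameter is $\theta=(\Theta,\beta)$ with $\Theta=\{\Theta_i\}_{i=1}^d$, $\Theta_i\in\mathbb R^{n_z\times d}$, and $\beta=\{\beta_i\}_{i=1}^d\in\mathcal B^d$. Throughout, the last column of each $\Theta_i$ is fixed to zero (this removes the translation invariance of softmax), and derivatives in $\Theta$ are taken within this subspace. $\mathbb T$ is the Euclidean space of all such $(\Theta,\beta)$; $\mathcal X_\beta\subseteq\mathcal B$ and $\mathcal X_f\subseteq\mathbb R^{n_g}$ are convex open sets, and $\mathcal X_\theta=\{(\Theta,\beta)\in\mathbb T:\beta\in\mathcal X_\beta^d\}$. Functions are set to $+\infty$ outside their domain. With $\mathrm{lse}(x)=\ln\sum_j e^{x_j}$ and $\sigma_i(x)=e^{x_i}/\sum_j e^{x_j}$, the latent modes $\xi_t\in\Xi$ and observations $y_t\in\mathbb R^{n_y}$ follow $$p(\xi_{t+1}\mid z_t,\xi_t=i;\Theta)=\sigma_{\xi_{t+1}}(\Theta_i^\top z_t),\qquad p(y_{t+1}\mid z_t,\xi_{t+1}=j;\beta)=C\exp[-f(G(y_{t+1},z_t,\beta_j))],$$ with $C>0$ independent of the parameters, $f:\mathcal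 X_f\to\mathbb R$, $G:\mathbb R^{n_y}\times\mathbb R^{n_z}\times\mathcal X_\beta\to\mathcal X_f$, and $z_t=\Upsilon(y_t,\dots,y_{t-t_y+1})\in\mathbb R^{n_z}$ for a known map $\Upsilon$. A trajectory $\mathbf y=\{y_t\}_{t=0}^T$ with initialization $z_0$ is given; $G_t(\cdot)=G(y_{t+1},z_t,\cdot)$. **Loss.** For $\boldsymbol\xi=(\xi_0,\dots,\xi_T)\in\Xi^{T+1}$ let $p(\mathbf y,\boldsymbol\xi,z_0;\theta)=p(\xi_0,z_0)\prod_{t=0}^{T-1}p(y_{t+1}\mid z_t,\xi_{t+1};\beta)\,p(\xi_{t+1}\mid z_t,\xi_t;\Theta)$, where $p(\xi_0,z_0)$ does not depend on $\theta$. Define vectors in $\mathbb R^{d^{T+1}}$ indexed by $\boldsymbol\xi$: $c_{\boldsymbol\xi}=\ln p(\xi_0,z_0)+T\ln C$ (real, so $p(\xi_0,z_0)>0$), $\Psi_{\boldsymbol\xi}(\Theta)=\sum_{t=0}^{T-1}[\mathrm{lse}(\Theta_{\xi_t}^\top z_t)-\Theta_{\xi_t,\xi_{t+1}}^\top z_t]$ (where $\Theta_{i,j}$ is the $j$-th column of $\Theta_i$), $\Phi_{\boldsymbol\xi}(\beta)=\sum_{t=0}^{T-1}f(G_t(\beta_{\xi_{t+1}}))$. The negative log-likelihood is $\mathcal L(\theta)=-\ln\sum_{\boldsymbol\xi}p(\mathbf y,\boldsymbol\xi,z_0;\theta)=-\mathrm{lse}(c-\Psi(\Theta)-\Phi(\beta))$,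 and $\bar{\mathcal L}=\mathcal L+\mathcal R$ with a regularizer $\mathcal R$. Let $\Pi_{\boldsymbol\xi}(\theta)=p(\boldsymbol\xi\mid\mathbf y,z_0;\theta)=p(\mathbf y,\boldsymbol\xi,z_0;\theta)/\sum_{\boldsymbol\xi'}p(\mathbf y,\boldsymbol\xi',z_0;\theta)$. **Assumption 1.** (a) The $i$-th entry of $G$ is $\beta\mapsto g_i(T_i(y,z,\beta))$ with $g_i$ strictly continuous (i.e. locally Lipschitz) and convex, and $T_i$ an affine mapping of $\beta$, for all $y\in\mathbb R^{n_y},z\in\mathbb R^{n_z}$. (b) $f$ is continuously differentiable, concave and strictly increasing with $\nabla f(x)>0$ component-wise, and $\|\nabla f(x)\|_\infty\le\bar u$ for all $x\in\mathcal X_f$, for some $\bar u\in(0,\infty)$. **Assumption 2.** $\mathcal R:\mathcal X_\theta\to\mathbb R$ satisfies $\mathcal R(\theta)=\mathcal R_1(\Theta)+\mathcal R_2(\beta)$ with $\mathcal R_1,\mathcal R_2$ convex, and there are $\kappa_1,\kappa_2>0$, $c_1,c_2\in\mathbb R$ such that for all $\boldsymbol\xi\in\Xi^{T+1}$: $\Psi_{\boldsymbol\xi}(\Theta)+\mathcal R_1(\Theta)\ge\kappa_1\|\Theta\|+c_1$ and $\Phi_{\boldsymbol\xi}(\beta)+\mathcal R_2(\beta)\ge\kappa_2\|\beta\|+c_2$. **EM++ algorithm.** Start from $\theta^0\in\mathcal X_\theta$. For $k=0,1,\dots$, set $\mathcal Q_1^k(\Theta)=\Pi(\theta^k)^\top\Psi(\Theta)$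 and $\mathcal Q_2^k(\beta)=\Pi(\theta^k)^\top\hat\Phi^k(\beta)$, where $\hat\Phi^k_{\boldsymbol\xi}(\beta)=\sum_{t=0}^{T-1}\big[f(G_t(\beta^k_{\xi_{t+1}}))+\langle\nabla f(G_t(\beta^k_{\xi_{t+1}})),G_t(\beta_{\xi_{t+1}})-G_t(\beta^k_{\xi_{t+1}})\rangle\big]$; then $\Theta^{k+1}\in\arg\min_\Theta\mathcal Q_1^k(\Theta)+\mathcal R_1(\Theta)$, $\beta^{k+1}\in\arg\min_\beta\mathcal Q_2^k(\beta)+\mathcal R_2(\beta)$, and $\theta^{k+1}=(\Theta^{k+1},\beta^{k+1})$. **Stationarity.** The directional derivative is $F'(\theta;v)=\lim_{\lambda\searrow0}(F(\theta+\lambda v)-F(\theta))/\lambda$. A point $\theta$ is stationary for $\bar{\mathcal L}$ if $\bar{\mathcal L}'(\theta;v)\ge0$ for all $v\in\mathbb T$.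
   Formalization: Only limit points lying in the domain X_θ are considered; iterates can converge to a boundary point of X_θ, where the regularized loss is +∞ and its directional derivative, hence stationarity, is undefined. *)

theory Defs
  imports "HOL-Analysis.Analysis"
begin

section \<open>General notions\<close>

definition lse :: "'i set \<Rightarrow> ('i \<Rightarrow> real) \<Rightarrow> real" where
  "lse I x = ln (\<Sum>j\<in>I. exp (x j))"

definition softmax :: "(real^'n) \<Rightarrow> 'n \<Rightarrow> real" where
  "softmax x i = exp (x $ i) / (\<Sum>j\<in>UNIV. exp (x $ j))"

definition affine_map :: "('a::real_vector \<Rightarrow> 'b::real_vector) \<Rightarrow> bool" where
  "affine_map h \<longleftrightarrow> (\<exists>L c. linear L \<and> h = (\<lambda>x. L x + c))"

text \<open>Strict continuity in the sense of Rockafellar and Wets, relative to the domain.\<close>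

definition strictly_continuous_on :: "'a::metric_space set \<Rightarrow> ('a \<Rightarrow> real) \<Rightarrow> bool" where
  "strictly_continuous_on D g \<longleftrightarrow>
     (\<forall>x\<in>D. \<exists>u>0. \<exists>L. L-lipschitz_on (cball x u \<inter> D) g)"

definition grad :: "('a::real_inner \<Rightarrow> real) \<Rightarrow> 'a \<Rightarrow> 'a" where
  "grad f x = (THE D. GDERIV f x :> D)"

definition extend_inf :: "'a set \<Rightarrow> ('a \<Rightarrow> real) \<Rightarrow> 'a \<Rightarrow> ereal" where
  "extend_inf S F x = (if x \<in> S then ereal (F x) else \<infinity>)"

definition is_minimizer :: "('a \<Rightarrow> ereal) \<Rightarrow> 'a \<Rightarrow> bool" where
  "is_minimizer F x \<longleftrightarrow> is_arg_min F (\<lambda>_. True) x"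

definition has_dir_derivative ::
    "('a::real_vector \<Rightarrow> ereal) \<Rightarrow> 'a \<Rightarrow> 'a \<Rightarrow> ereal \<Rightarrow> bool" where
  "has_dir_derivative F x v D \<longleftrightarrow>
     ((\<lambda>l::real. (F (x + l *\<^sub>R v) - F x) / ereal l) \<longlongrightarrow> D) (at_right 0)"

text \<open>The existence of the directional derivatives is part of stationarity. The argument \<open>V\<close> is
  the linear space of admissible directions.\<close>

definition stationary_point :: "'a::real_vector set \<Rightarrow> ('a \<Rightarrow> ereal) \<Rightarrow> 'a \<Rightarrow> bool" where
  "stationary_point V F x \<longleftrightarrow> (\<forall>v\<in>V. \<exists>D. has_dir_derivative F x v D \<and> 0 \<le> D)"

section \<open>The switching model\<close>

text \<open>The modes \<open>{1..d}\<close> are the elements of a finite linearly ordered type \<open>'d\<close>, so that there is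
  a last mode. Observations are indexed by integers: \<open>z\<^sub>0\<close> is given, but for memory length
  greater than 2 the regressors \<open>z\<^sub>1, z\<^sub>2, \<dots>\<close> also read observations before time 0. These are
  arbitrary known data. The regressor map receives the list \<open>[y\<^sub>t, \<dots>, y\<^bsub>t - t_y + 1\<^esub>]\<close>.\<close>

record ('d, 'ny, 'nz, 'ng, 'b) switching_model =
  horizon :: nat
  memory :: nat
  regressor :: "(real^'ny) list \<Rightarrow> real^'nz"
  obs :: "int \<Rightarrow> real^'ny"
  z_init :: "real^'nz"
  p_init :: "'d \<Rightarrow> real^'nz \<Rightarrow> real"
  obs_const :: real
  f_dom :: "(real^'ng) set"
  f_fun :: "real^'ng \<Rightarrow> real"
  beta_dom :: "'b set"
  G_fun :: "real^'ny \<Rightarrow> real^'nz \<Rightarrow> 'b \<Rightarrow> real^'ng"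

type_synonym ('d, 'nz) theta1 = "real^'d^'nz^'d"
type_synonym ('d, 'b) theta2 = "'b^'d"
type_synonym ('d, 'nz, 'b) param = "('d, 'nz) theta1 \<times> ('d, 'b) theta2"

definition last_mode :: "'d::{finite,linorder}" where
  "last_mode = Max UNIV"

definition Theta_space :: "('d::{finite,linorder}, 'nz::finite) theta1 set" where
  "Theta_space = {\<Theta>. \<forall>i. column last_mode (\<Theta> $ i) = 0}"

definition param_space ::
    "('d::{finite,linorder}, 'nz::finite, 'b::euclidean_space) param set" where
  "param_space = Theta_space \<times> UNIV"

definition betas_dom ::
    "('d::finite, 'ny::finite, 'nz::finite, 'ng::finite, 'b) switching_model \<Rightarrow> ('d, 'b) theta2 set" where
  "betas_dom M = {\<beta>. \<forall>i. \<beta> $ i \<in> beta_dom M}"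

definition param_dom ::
    "('d::{finite,linorder}, 'ny::finite, 'nz::finite, 'ng::finite, 'b::euclidean_space) switching_model
      \<Rightarrow> ('d, 'nz, 'b) param set" where
  "param_dom M = Theta_space \<times> betas_dom M"

definition well_formed_model ::
    "('d::finite, 'ny::finite, 'nz::finite, 'ng::finite, 'b::euclidean_space) switching_model
      \<Rightarrow> bool" where
  "well_formed_model M \<longleftrightarrow>
     horizon M \<ge> 1 \<and> memory M \<ge> 1 \<and> obs_const M > 0 \<and>
     (\<forall>i. p_init M i (z_init M) > 0) \<and>
     convex (beta_dom M) \<and> open (beta_dom M) \<and>
     convex (f_dom M) \<and> open (f_dom M) \<and>
     (\<forall>y z. \<forall>\<beta>\<in>beta_dom M. G_fun M y z \<beta> \<in> f_dom M)"

definition z_at ::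
    "('d, 'ny::finite, 'nz::finite, 'ng::finite, 'b) switching_model \<Rightarrow> nat \<Rightarrow> real^'nz" where
  "z_at M t =
     (if t = 0 then z_init M
      else regressor M (map (\<lambda>s. obs M (int t - int s)) [0..<memory M]))"

definition transition_prob ::
    "('d::finite, 'nz::finite) theta1 \<Rightarrow> real^'nz \<Rightarrow> 'd \<Rightarrow> 'd \<Rightarrow> real" where
  "transition_prob \<Theta> z i j = softmax (transpose (\<Theta> $ i) *v z) j"

definition obs_density ::
    "('d::finite, 'ny::finite, 'nz::finite, 'ng::finite, 'b) switching_model
      \<Rightarrow> ('d, 'b) theta2 \<Rightarrow> real^'ny \<Rightarrow> real^'nz \<Rightarrow> 'd \<Rightarrow> real" where
  "obs_density M \<beta> y z j = obs_const M * exp (- f_fun M (G_fun M y z (\<beta> $ j)))"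

definition mode_paths ::
    "('d::finite, 'ny::finite, 'nz::finite, 'ng::finite, 'b) switching_model
      \<Rightarrow> (nat \<Rightarrow> 'd) set" where
  "mode_paths M = {..horizon M} \<rightarrow>\<^sub>E UNIV"

definition joint_density ::
    "('d::finite, 'ny::finite, 'nz::finite, 'ng::finite, 'b) switching_model
      \<Rightarrow> ('d, 'nz, 'b) param \<Rightarrow> (nat \<Rightarrow> 'd) \<Rightarrow> real" where
  "joint_density M \<theta> \<xi> =
     p_init M (\<xi> 0) (z_init M) *
     (\<Prod>t<horizon M.
        obs_density M (snd \<theta>) (obs M (int (Suc t))) (z_at M t) (\<xi> (Suc t)) *
        transition_prob (fst \<theta>) (z_at M t) (\<xi> t) (\<xi> (Suc t)))"

definition posterior ::
    "('d::finite, 'ny::finite, 'nz::finite, 'ng::finite, 'b) switching_model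
      \<Rightarrow> ('d, 'nz, 'b) param \<Rightarrow> (nat \<Rightarrow> 'd) \<Rightarrow> real" where
  "posterior M \<theta> \<xi> = joint_density M \<theta> \<xi> / (\<Sum>\<xi>'\<in>mode_paths M. joint_density M \<theta> \<xi>')"

definition neg_log_lik ::
    "('d::finite, 'ny::finite, 'nz::finite, 'ng::finite, 'b) switching_model
      \<Rightarrow> ('d, 'nz, 'b) param \<Rightarrow> real" where
  "neg_log_lik M \<theta> = - ln (\<Sum>\<xi>\<in>mode_paths M. joint_density M \<theta> \<xi>)"

definition log_const ::
    "('d::finite, 'ny::finite, 'nz::finite, 'ng::finite, 'b) switching_model
      \<Rightarrow> (nat \<Rightarrow> 'd) \<Rightarrow> real" where
  "log_const M \<xi> = ln (p_init M (\<xi> 0) (z_init M)) + real (horizon M) * ln (obs_const M)"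

definition Psi ::
    "('d::finite, 'ny::finite, 'nz::finite, 'ng::finite, 'b) switching_model
      \<Rightarrow> ('d, 'nz) theta1 \<Rightarrow> (nat \<Rightarrow> 'd) \<Rightarrow> real" where
  "Psi M \<Theta> \<xi> =
     (\<Sum>t<horizon M.
        lse UNIV (\<lambda>j. (transpose (\<Theta> $ \<xi> t) *v z_at M t) $ j)
        - column (\<xi> (Suc t)) (\<Theta> $ \<xi> t) \<bullet> z_at M t)"

definition G_at ::
    "('d, 'ny::finite, 'nz::finite, 'ng::finite, 'b) switching_model
      \<Rightarrow> nat \<Rightarrow> 'b \<Rightarrow> real^'ng" where
  "G_at M t b = G_fun M (obs M (int (Suc t))) (z_at M t) b"

definition Phi ::
    "('d::finite, 'ny::finite, 'nz::finite, 'ng::finite, 'b) switching_model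
      \<Rightarrow> ('d, 'b) theta2 \<Rightarrow> (nat \<Rightarrow> 'd) \<Rightarrow> real" where
  "Phi M \<beta> \<xi> = (\<Sum>t<horizon M. f_fun M (G_at M t (\<beta> $ \<xi> (Suc t))))"

section \<open>Assumptions\<close>

text \<open>All \<open>g\<^sub>i\<close> live on subsets \<open>D i\<close> of one Euclidean space: inner spaces of different dimension
  embed into a common one. Taking \<open>D i = UNIV\<close> gives everywhere finite \<open>g\<^sub>i\<close>.\<close>

definition subsystem_assumption ::
    "('d::finite, 'ny::finite, 'nz::finite, 'ng::finite, 'b::euclidean_space) switching_model
      \<Rightarrow> ('ng \<Rightarrow> 'm::euclidean_space set) \<Rightarrow> ('ng \<Rightarrow> 'm \<Rightarrow> real)
      \<Rightarrow> ('ng \<Rightarrow> real^'ny \<Rightarrow> real^'nz \<Rightarrow> 'b \<Rightarrow> 'm) \<Rightarrow> bool" where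
  "subsystem_assumption M D g A \<longleftrightarrow>
     (\<forall>i. strictly_continuous_on (D i) (g i) \<and> convex_on (D i) (g i)) \<and>
     (\<forall>i y z. affine_map (A i y z)) \<and>
     (\<forall>i y z. \<forall>\<beta>\<in>beta_dom M. A i y z \<beta> \<in> D i \<and> G_fun M y z \<beta> $ i = g i (A i y z \<beta>)) \<and>
     (\<forall>x\<in>f_dom M. \<exists>d. GDERIV (f_fun M) x :> d) \<and>
     continuous_on (f_dom M) (grad (f_fun M)) \<and>
     concave_on (f_dom M) (f_fun M) \<and>
     strict_mono_on (f_dom M) (f_fun M) \<and>
     (\<forall>x\<in>f_dom M. \<forall>i. grad (f_fun M) x $ i > 0) \<and>
     (\<exists>u>0. \<forall>x\<in>f_dom M. infnorm (grad (f_fun M) x) \<le> u)"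

definition regularizer_assumption ::
    "('d::{finite,linorder}, 'ny::finite, 'nz::finite, 'ng::finite, 'b::euclidean_space) switching_model
      \<Rightarrow> (('d, 'nz, 'b) param \<Rightarrow> real) \<Rightarrow> (('d, 'nz) theta1 \<Rightarrow> real) \<Rightarrow> (('d, 'b) theta2 \<Rightarrow> real)
      \<Rightarrow> bool" where
  "regularizer_assumption M R R1 R2 \<longleftrightarrow>
     (\<forall>\<theta>\<in>param_dom M. R \<theta> = R1 (fst \<theta>) + R2 (snd \<theta>)) \<and>
     convex_on Theta_space R1 \<and> convex_on (betas_dom M) R2 \<and>
     (\<exists>\<kappa>1>0. \<exists>\<kappa>2>0. \<exists>c1 c2. \<forall>\<xi>\<in>mode_paths M.
        (\<forall>\<Theta>\<in>Theta_space. Psi M \<Theta> \<xi> + R1 \<Theta> \<ge> \<kappa>1 * norm \<Theta> + c1) \<and>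
        (\<forall>\<beta>\<in>betas_dom M. Phi M \<beta> \<xi> + R2 \<beta> \<ge> \<kappa>2 * norm \<beta> + c2))"

definition reg_loss ::
    "('d::{finite,linorder}, 'ny::finite, 'nz::finite, 'ng::finite, 'b::euclidean_space) switching_model
      \<Rightarrow> (('d, 'nz, 'b) param \<Rightarrow> real) \<Rightarrow> ('d, 'nz, 'b) param \<Rightarrow> ereal" where
  "reg_loss M R = extend_inf (param_dom M) (\<lambda>\<theta>. neg_log_lik M \<theta> + R \<theta>)"

section \<open>The EM++ algorithm\<close>

definition Q1 ::
    "('d::finite, 'ny::finite, 'nz::finite, 'ng::finite, 'b) switching_model
      \<Rightarrow> ('d, 'nz, 'b) param \<Rightarrow> ('d, 'nz) theta1 \<Rightarrow> real" where
  "Q1 M \<theta> \<Theta> = (\<Sum>\<xi>\<in>mode_paths M. posterior M \<theta> \<xi> * Psi M \<Theta> \<xi>)"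

definition Phi_hat ::
    "('d::finite, 'ny::finite, 'nz::finite, 'ng::finite, 'b) switching_model
      \<Rightarrow> ('d, 'b) theta2 \<Rightarrow> ('d, 'b) theta2 \<Rightarrow> (nat \<Rightarrow> 'd) \<Rightarrow> real" where
  "Phi_hat M \<beta>k \<beta> \<xi> =
     (\<Sum>t<horizon M.
        f_fun M (G_at M t (\<beta>k $ \<xi> (Suc t)))
        + grad (f_fun M) (G_at M t (\<beta>k $ \<xi> (Suc t)))
            \<bullet> (G_at M t (\<beta> $ \<xi> (Suc t)) - G_at M t (\<beta>k $ \<xi> (Suc t))))"

definition Q2 ::
    "('d::finite, 'ny::finite, 'nz::finite, 'ng::finite, 'b) switching_model
      \<Rightarrow> ('d, 'nz, 'b) param \<Rightarrow> ('d, 'b) theta2 \<Rightarrow> real" where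
  "Q2 M \<theta> \<beta> = (\<Sum>\<xi>\<in>mode_paths M. posterior M \<theta> \<xi> * Phi_hat M (snd \<theta>) \<beta> \<xi>)"

definition EMpp_iterates ::
    "('d::{finite,linorder}, 'ny::finite, 'nz::finite, 'ng::finite, 'b::euclidean_space) switching_model
      \<Rightarrow> (('d, 'nz) theta1 \<Rightarrow> real) \<Rightarrow> (('d, 'b) theta2 \<Rightarrow> real)
      \<Rightarrow> (nat \<Rightarrow> ('d, 'nz, 'b) param) \<Rightarrow> bool" where
  "EMpp_iterates M R1 R2 \<theta> \<longleftrightarrow>
     \<theta> 0 \<in> param_dom M \<and>
     (\<forall>k. is_minimizer (extend_inf Theta_space (\<lambda>\<Theta>. Q1 M (\<theta> k) \<Theta> + R1 \<Theta>)) (fst (\<theta> (Suc k))) \<and>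
          is_minimizer (extend_inf (betas_dom M) (\<lambda>\<beta>. Q2 M (\<theta> k) \<beta> + R2 \<beta>)) (snd (\<theta> (Suc k))))"

section \<open>The loss in terms of the vectors \<open>c\<close>, \<open>\<Psi>\<close> and \<open>\<Phi>\<close>\<close>

lemma neg_log_lik_eq:
  fixes M :: "('d::finite, 'ny::finite, 'nz::finite, 'ng::finite, 'b::euclidean_space) switching_model"
  assumes "well_formed_model M"
  shows "neg_log_lik M \<theta> =
    - lse (mode_paths M) (\<lambda>\<xi>. log_const M \<xi> - Psi M (fst \<theta>) \<xi> - Phi M (snd \<theta>) \<xi>)"
proof -
  have C: "obs_const M > 0" and p: "\<And>i. p_init M i (z_init M) > 0"
    using assms by (auto simp: well_formed_model_def)
  have sm: "softmax x j = exp (x $ j - lse UNIV (\<lambda>j. x $ j))" for x :: "real^'d" and j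
    by (simp add: softmax_def lse_def exp_diff sum_pos)
  have col: "(z v* A) $ j = column j A \<bullet> z" for A :: "real^'d^'nz" and z j
    by (simp add: vector_matrix_mult_def column_def inner_vec_def mult.commute)
  have "joint_density M \<theta> \<xi> = exp (log_const M \<xi> - Psi M (fst \<theta>) \<xi> - Phi M (snd \<theta>) \<xi>)" for \<xi>
  proof -
    have "exp (log_const M \<xi>) = p_init M (\<xi> 0) (z_init M) * obs_const M ^ horizon M"
      using C p by (simp add: log_const_def exp_add exp_of_nat_mult)
    moreover have "exp (- Phi M (snd \<theta>) \<xi>) =
        (\<Prod>t<horizon M. exp (- f_fun M (G_at M t (snd \<theta> $ \<xi> (Suc t)))))"
      by (simp add: Phi_def exp_sum flip: sum_negf)
    moreover have "exp (- Psi M (fst \<theta>) \<xi>) =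
        (\<Prod>t<horizon M. transition_prob (fst \<theta>) (z_at M t) (\<xi> t) (\<xi> (Suc t)))"
      by (simp add: Psi_def transition_prob_def sm col exp_sum flip: sum_negf)
    ultimately have "exp (log_const M \<xi> + - Psi M (fst \<theta>) \<xi> + - Phi M (snd \<theta>) \<xi>) = joint_density M \<theta> \<xi>"
      unfolding exp_add joint_density_def obs_density_def G_at_def
      by (simp add: prod.distrib)
    then show ?thesis by simp
  qed
  then show ?thesis by (simp add: neg_log_lik_def lse_def)
qed

end

theory Submission
  imports Defs
begin

text \<open>EM++ is a majorization-minimization method. For an anchor \<open>\<theta>'\<close> let \<open>S(\<theta>', \<theta>)\<close> be the surrogate
  \<open>Q1 + R1 + Q2 + R2\<close> formed at \<open>\<theta>'\<close>; an EM++ step minimizes \<open>S(\<theta>', \<cdot>)\<close>. Two facts relate it to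
  the regularized loss \<open>L\<close>.

  \<^item> Majorization (\<open>loss_diff_le_surrogate_diff\<close>): \<open>L(\<theta>) - L(\<theta>') \<le> S(\<theta>', \<theta>) - S(\<theta>', \<theta>')\<close>. Passing
    from the log of a sum to the posterior average is Jensen's inequality, and linearizing the
    concave \<open>f\<close> around the anchor only increases it.
  \<^item> First-order agreement (\<open>loss_surrogate_right_derivative\<close>): at the anchor, \<open>L\<close> and \<open>S(\<theta>', \<cdot>)\<close>
    have the same right derivative along every admissible direction. These derivatives exist,
    because the nonsmooth ingredients \<open>G\<close>, \<open>R1\<close> and \<open>R2\<close> are convex and enter only inside sums or
    under smooth functions; the two derivatives agree because the softmax weights of the
    log-sum-exp at the anchor are the posterior.

  By majorization \<open>L\<close> decreases along the iterates, and along the convergent subsequence its values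
  tend to \<open>L\<close> at the limit point, which is thus a lower bound of all of them. So for every \<open>\<theta>\<close> in
  the domain and every iterate \<open>\<theta>\<^sub>k\<close> of the subsequence,
  \<open>S(\<theta>\<^sub>k, \<theta>) - S(\<theta>\<^sub>k, \<theta>\<^sub>k) \<ge> L(\<theta>\<^sub>k\<^sub>+\<^sub>1) - L(\<theta>\<^sub>k) \<ge> L(\<theta>lim) - L(\<theta>\<^sub>k)\<close>, and the right-hand side tends
  to 0. Continuity of \<open>S\<close> in the anchor yields \<open>S(\<theta>lim, \<theta>) \<ge> S(\<theta>lim, \<theta>lim)\<close>
  (\<open>limit_point_minimizes_own_surrogate\<close>): the limit point is a fixed point of the method, although
  the minimizers themselves need not converge. The right derivatives of \<open>S(\<theta>lim, \<cdot>)\<close> at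
  \<open>\<theta>lim\<close> are therefore nonnegative, and by first-order agreement so are those of \<open>L\<close>.\<close>

section \<open>One-sided derivatives and convexity\<close>

lemma convex_on_affine_comp:
  fixes F :: "'b::real_vector \<Rightarrow> real"
  assumes "convex_on S F" "convex C" "linear L" "\<And>x. x \<in> C \<Longrightarrow> L x + c \<in> S"
  shows "convex_on C (\<lambda>x. F (L x + c))"
proof
  fix t :: real and x y
  assume t: "0 < t" "t < 1" and xy: "x \<in> C" "y \<in> C"
  have "L ((1 - t) *\<^sub>R x + t *\<^sub>R y) + c = (1 - t) *\<^sub>R (L x + c) + t *\<^sub>R (L y + c)"
    unfolding linear_add[OF assms(3)] linear_scale[OF assms(3)] by (simp add: algebra_simps)
  then show "F (L ((1 - t) *\<^sub>R x + t *\<^sub>R y) + c) \<le> (1 - t) * F (L x + c) + t * F (L y + c)"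
    using convex_onD[OF assms(1), of t "L x + c" "L y + c"] t xy assms(4) by auto
qed (fact assms(2))

text \<open>The difference quotient of a convex function is increasing, and it is bounded below by the
  quotient at any point on the opposite side.\<close>

lemma convex_on_right_derivative:
  fixes F :: "'a::real_normed_vector \<Rightarrow> real"
  assumes "open S" "convex_on S F" "x \<in> S"
  shows "\<exists>D. ((\<lambda>l. F (x + l *\<^sub>R w)) has_real_derivative D) (at_right 0)"
proof -
  define \<phi> where "\<phi> l = F (x + l *\<^sub>R w)" for l
  define I where "I = {l::real. x + l *\<^sub>R w \<in> S}"
  have "open ((\<lambda>l::real. x + l *\<^sub>R w) -` S)"
    by (intro open_vimage assms continuous_intros)
  then have "open I" by (simp add: I_def vimage_def)
  moreover have "0 \<in> I" using assms by (simp add: I_def)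
  ultimately obtain e where e: "e > 0" "cball 0 e \<subseteq> I"
    using open_contains_cball by blast
  have lin: "linear (\<lambda>l::real. l *\<^sub>R w)"
    by (simp add: linear_iff scaleR_add_left)
  have "convex_on {-e..e} (\<lambda>l. F (l *\<^sub>R w + x))"
    by (rule convex_on_affine_comp[OF assms(2) _ lin])
      (use e in \<open>auto simp: I_def subset_iff dist_real_def add.commute\<close>)
  then have cvx: "convex_on {-e..e} \<phi>"
    by (simp add: \<phi>_def[abs_def] add.commute)
  let ?q = "\<lambda>l. (\<phi> l - \<phi> 0) / (l - 0)"
  have mono: "?q a \<le> ?q b" if "a \<in> {..<e}" "b \<in> {..<e}" "0 < a" "a \<le> b" for a b
  proof (cases "a = b")
    case False
    then have "(\<phi> 0 - \<phi> a) / (0 - a) \<le> (\<phi> 0 - \<phi> b) / (0 - b)"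
      using that e by (intro convex_on_slope_le[OF cvx]) auto
    then show ?thesis using that False by (simp add: field_simps)
  qed simp
  have bnd: "(\<phi> (-e) - \<phi> 0) / (-e - 0) \<le> ?q a" if "a \<in> {..<e}" "0 < a" for a
  proof -
    have "(\<phi> (-e) - \<phi> 0) / (-e - 0) \<le> (\<phi> (-e) - \<phi> a) / (-e - a)"
      using that e by (intro convex_on_slope_le[OF cvx]) auto
    also have "\<dots> \<le> (\<phi> 0 - \<phi> a) / (0 - a)"
      using that e by (intro convex_on_slope_le[OF cvx]) auto
    finally show ?thesis using that by (simp add: field_simps)
  qed
  have "at 0 within {0<..} \<inter> {..<e} = at_right (0::real)"
    using e by (intro at_within_nhd[of _ "{-e<..<e}"]) auto
  with Lim_right_bound[of "{..<e}" 0 ?q, OF mono bnd]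
  obtain D where "(?q \<longlongrightarrow> D) (at_right 0)" by auto
  then show ?thesis
    by (auto simp: has_field_derivative_iff \<phi>_def)
qed

lemma GDERIV_grad:
  assumes "GDERIV f x :> d"
  shows "GDERIV f x :> grad f x"
proof -
  have "d' = d" if "GDERIV f x :> d'" for d'
  proof -
    have "(\<lambda>h. h \<bullet> d') = (\<lambda>h. h \<bullet> d)"
      using that assms by (auto simp: gderiv_def intro: has_derivative_unique)
    then show ?thesis
      by (metis inner_commute vector_eq_rdot)
  qed
  with assms have "\<exists>!d. GDERIV f x :> d" by auto
  then show ?thesis unfolding grad_def by (rule theI')
qed

lemma GDERIV_chain_right:
  fixes p :: "real \<Rightarrow> 'a::real_inner"
  assumes "GDERIV f (p x) :> d" "(p has_vector_derivative p') (at x within S)"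
  shows "((\<lambda>l. f (p l)) has_real_derivative d \<bullet> p') (at x within S)"
proof -
  have "((f \<circ> p) has_vector_derivative p' \<bullet> d) (at x within S)"
    using assms by (intro vector_derivative_diff_chain_within)
      (auto simp: gderiv_def intro: has_derivative_at_withinI)
  then show ?thesis
    by (simp add: o_def has_real_derivative_iff_has_vector_derivative inner_commute)
qed

lemma has_vector_derivative_vec:
  fixes p :: "real \<Rightarrow> real^'n"
  assumes "\<And>i. ((\<lambda>l. p l $ i) has_real_derivative p' i) (at x within S)"
  shows "(p has_vector_derivative (\<chi> i. p' i)) (at x within S)"
  unfolding has_vector_derivative_def
  by (subst has_derivative_componentwise_within)
    (use assms in \<open>auto simp: Basis_vec_def inner_axis has_field_derivative_def mult_commute_abs\<close>)

text \<open>A concave function stays below its tangents: the difference quotients along the segment are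
  at least the full increment, so their limit is too.\<close>

lemma concave_on_le_tangent:
  fixes f :: "'a::real_inner \<Rightarrow> real"
  assumes "concave_on S f" "x \<in> S" "y \<in> S" "GDERIV f x :> d"
  shows "f y \<le> f x + d \<bullet> (y - x)"
proof -
  have "((\<lambda>l. x + l *\<^sub>R (y - x)) has_vector_derivative (y - x)) (at_right 0)"
    by (auto intro!: derivative_eq_intros simp: has_vector_derivative_def)
  then have "((\<lambda>l. f (x + l *\<^sub>R (y - x))) has_real_derivative d \<bullet> (y - x)) (at_right 0)"
    using assms(4) by (intro GDERIV_chain_right) auto
  then have "((\<lambda>l. (f (x + l *\<^sub>R (y - x)) - f x) / l) \<longlongrightarrow> d \<bullet> (y - x)) (at_right 0)"
    by (simp add: has_field_derivative_iff)
  moreover have "\<forall>\<^sub>F l in at_right 0. f y - f x \<le> (f (x + l *\<^sub>R (y - x)) - f x) / l"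
    unfolding eventually_at_right[OF zero_less_one]
  proof (intro exI[of _ 1] conjI allI impI)
    fix l :: real
    assume l: "0 < l" "l < 1"
    have "x + l *\<^sub>R (y - x) = (1 - l) *\<^sub>R x + l *\<^sub>R y" by (simp add: algebra_simps)
    then have "f (x + l *\<^sub>R (y - x)) \<ge> (1 - l) * f x + l * f y"
      using assms(1-3) l by (simp add: concave_on_iff)
    then show "f y - f x \<le> (f (x + l *\<^sub>R (y - x)) - f x) / l"
      using l by (simp add: field_simps)
  qed simp
  ultimately have "f y - f x \<le> d \<bullet> (y - x)"
    by (intro tendsto_lowerbound) auto
  then show ?thesis by simp
qed

text \<open>The derivative of a log-sum-exp is the average of the inner derivatives under the softmax
  weights. For the log-likelihood these weights are the posterior.\<close>

lemma neg_lse_has_derivative: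
  fixes h :: "'i \<Rightarrow> real \<Rightarrow> real"
  assumes "finite I" "I \<noteq> {}"
    and "\<And>i. i \<in> I \<Longrightarrow> (h i has_real_derivative h' i) (at x within S)"
  shows "((\<lambda>l. - ln (\<Sum>i\<in>I. exp (c i - h i l))) has_real_derivative
      (\<Sum>i\<in>I. exp (c i - h i x) / (\<Sum>j\<in>I. exp (c j - h j x)) * h' i)) (at x within S)"
proof -
  have pos: "(\<Sum>i\<in>I. exp (c i - h i x)) > 0" using assms by (intro sum_pos) auto
  have "((\<lambda>l. \<Sum>i\<in>I. exp (c i - h i l)) has_real_derivative
      (\<Sum>i\<in>I. exp (c i - h i x) * (- h' i))) (at x within S)"
  proof (intro DERIV_sum DERIV_chain2[OF DERIV_exp])
    show "((\<lambda>l. c i - h i l) has_real_derivative - h' i) (at x within S)" if "i \<in> I" for i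
      using DERIV_diff[OF DERIV_const assms(3)[OF that]] by simp
  qed
  from DERIV_minus[OF DERIV_chain2[OF DERIV_ln_divide[OF pos] this]]
  have "((\<lambda>l. - ln (\<Sum>i\<in>I. exp (c i - h i l))) has_real_derivative
      - (1 / (\<Sum>i\<in>I. exp (c i - h i x)) * (\<Sum>i\<in>I. exp (c i - h i x) * (- h' i)))) (at x within S)" .
  then show ?thesis
    by (simp add: sum_negf sum_divide_distrib)
qed

text \<open>Jensen's inequality for \<open>exp\<close>, obtained by averaging \<open>1 + t \<le> exp t\<close> at
  \<open>t = a i - (\<Sum>j. w j * a j)\<close>.\<close>

lemma average_le_ln_average_exp:
  fixes w a :: "'i \<Rightarrow> real"
  assumes "\<And>i. i \<in> I \<Longrightarrow> w i \<ge> 0" "sum w I = 1"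
  shows "(\<Sum>i\<in>I. w i * a i) \<le> ln (\<Sum>i\<in>I. w i * exp (a i))"
proof -
  define m where "m = (\<Sum>i\<in>I. w i * a i)"
  have "1 = (\<Sum>i\<in>I. w i * (1 + (a i - m)))"
    by (simp add: ring_distribs sum.distrib sum_subtractf assms(2) m_def flip: sum_distrib_right)
  also have "\<dots> \<le> (\<Sum>i\<in>I. w i * exp (a i - m))"
    using assms(1) by (intro sum_mono mult_left_mono exp_ge_add_one_self) auto
  also have "\<dots> = (\<Sum>i\<in>I. w i * exp (a i)) / exp m"
    by (simp add: exp_diff sum_divide_distrib)
  finally have "exp m \<le> (\<Sum>i\<in>I. w i * exp (a i))" by (simp add: field_simps)
  then have "ln (exp m) \<le> ln (\<Sum>i\<in>I. w i * exp (a i))"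
    by (intro ln_mono) (auto intro: less_le_trans)
  then show ?thesis by (simp add: m_def)
qed

section \<open>The switching model\<close>

lemma transpose_mult_nth: "(transpose A *v z) $ j = column j A \<bullet> z" for A :: "real^'d^'nz"
  by (simp add: matrix_vector_mult_def transpose_def column_def inner_vec_def)

lemma softmax_eq_exp: "softmax x j = exp (x $ j - lse UNIV (\<lambda>j. x $ j))"
  by (simp add: softmax_def lse_def exp_diff sum_pos)

lemma column_line: "column j ((\<Theta> + l *\<^sub>R V) $ i) \<bullet> z = column j (\<Theta> $ i) \<bullet> z + l * (column j (V $ i) \<bullet> z)"
  for \<Theta> V :: "('d::finite, 'nz::finite) theta1"
  by (simp add: column_def inner_vec_def distrib_right sum.distrib sum_distrib_left mult.assoc)

text \<open>A proper subspace has empty interior, so the theorems on convex functions on open sets do not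
  apply to \<open>R1\<close> on \<open>Theta_space\<close>. They do apply to its composition with this projection, which is
  convex on the whole space and agrees with \<open>R1\<close> on the subspace.\<close>

definition Theta_proj :: "('d::{finite,linorder}, 'nz::finite) theta1 \<Rightarrow> ('d, 'nz) theta1" where
  "Theta_proj \<Theta> = (\<chi> i a j. if j = last_mode then 0 else \<Theta> $ i $ a $ j)"

lemma linear_Theta_proj: "linear Theta_proj"
  by (simp add: linear_iff Theta_proj_def vec_eq_iff)

lemma Theta_proj_in: "Theta_proj \<Theta> \<in> Theta_space"
  by (simp add: Theta_space_def Theta_proj_def column_def vec_eq_iff)

lemma Theta_proj_id: "\<Theta> \<in> Theta_space \<Longrightarrow> Theta_proj \<Theta> = \<Theta>"
  by (auto simp: Theta_space_def Theta_proj_def column_def vec_eq_iff)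

lemma Theta_space_line: "\<lbrakk>\<Theta> \<in> Theta_space; V \<in> Theta_space\<rbrakk> \<Longrightarrow> \<Theta> + l *\<^sub>R V \<in> Theta_space"
  by (simp add: Theta_space_def column_def vec_eq_iff)

definition surrogate ::
    "('d::{finite,linorder}, 'ny::finite, 'nz::finite, 'ng::finite, 'b::euclidean_space) switching_model
      \<Rightarrow> (('d, 'nz) theta1 \<Rightarrow> real) \<Rightarrow> (('d, 'b) theta2 \<Rightarrow> real)
      \<Rightarrow> ('d, 'nz, 'b) param \<Rightarrow> ('d, 'nz, 'b) param \<Rightarrow> real" where
  "surrogate M R1 R2 \<theta>' \<theta> =
     (Q1 M \<theta>' (fst \<theta>) + R1 (fst \<theta>)) + (Q2 M \<theta>' (snd \<theta>) + R2 (snd \<theta>))"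

text \<open>On \<open>param_dom M\<close> this is the regularized loss. The regularizers are kept as functions of all
  matrices and all \<open>\<beta>\<close>, so that the derivative along a line can be computed summand by summand.\<close>

definition split_loss ::
    "('d::{finite,linorder}, 'ny::finite, 'nz::finite, 'ng::finite, 'b::euclidean_space) switching_model
      \<Rightarrow> (('d, 'nz) theta1 \<Rightarrow> real) \<Rightarrow> (('d, 'b) theta2 \<Rightarrow> real) \<Rightarrow> ('d, 'nz, 'b) param \<Rightarrow> real" where
  "split_loss M R1 R2 \<theta> = neg_log_lik M \<theta> + (R1 (fst \<theta>) + R2 (snd \<theta>))"

locale em_setting =
  fixes M :: "('d::{finite,linorder}, 'ny::finite, 'nz::finite, 'ng::finite, 'b::euclidean_space)
                switching_model"
    and D :: "'ng \<Rightarrow> 'm::euclidean_space set"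
    and g :: "'ng \<Rightarrow> 'm \<Rightarrow> real"
    and A :: "'ng \<Rightarrow> real^'ny \<Rightarrow> real^'nz \<Rightarrow> 'b \<Rightarrow> 'm"
    and R :: "('d, 'nz, 'b) param \<Rightarrow> real"
    and R1 :: "('d, 'nz) theta1 \<Rightarrow> real"
    and R2 :: "('d, 'b) theta2 \<Rightarrow> real"
  assumes wf: "well_formed_model M"
    and sub: "subsystem_assumption M D g A"
    and reg: "regularizer_assumption M R R1 R2"
begin

lemma finite_paths [simp]: "finite (mode_paths M)"
  unfolding mode_paths_def by (intro finite_PiE) auto

lemma paths_nonempty [simp]: "mode_paths M \<noteq> {}"
  by (simp add: mode_paths_def PiE_eq_empty_iff)

lemma open_betas: "open (betas_dom M)"
  using wf unfolding betas_dom_def well_formed_model_def by (intro open_vector_box) auto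

lemma betas_domD: "\<beta> \<in> betas_dom M \<Longrightarrow> \<beta> $ i \<in> beta_dom M"
  by (simp add: betas_dom_def)

lemma param_domD: "\<theta> \<in> param_dom M \<Longrightarrow> fst \<theta> \<in> Theta_space" "\<theta> \<in> param_dom M \<Longrightarrow> snd \<theta> \<in> betas_dom M"
  by (auto simp: param_dom_def)

lemma G_at_in: "b \<in> beta_dom M \<Longrightarrow> G_at M t b \<in> f_dom M"
  using wf by (auto simp: well_formed_model_def G_at_def)

lemma reg_loss_eq: "\<theta> \<in> param_dom M \<Longrightarrow> reg_loss M R \<theta> = ereal (split_loss M R1 R2 \<theta>)"
  using reg by (simp add: reg_loss_def extend_inf_def split_loss_def regularizer_assumption_def)

subsection \<open>Joint density and posterior\<close>

lemma joint_density_eq: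
  "joint_density M \<theta> \<xi> = exp (log_const M \<xi> - (Psi M (fst \<theta>) \<xi> + Phi M (snd \<theta>) \<xi>))"
proof -
  have pos: "obs_const M > 0" "p_init M (\<xi> 0) (z_init M) > 0"
    using wf by (auto simp: well_formed_model_def)
  have "joint_density M \<theta> \<xi> = p_init M (\<xi> 0) (z_init M) *
      (\<Prod>t<horizon M. exp (ln (obs_const M) - f_fun M (G_at M t (snd \<theta> $ \<xi> (Suc t)))
        - (lse UNIV (\<lambda>j. (transpose (fst \<theta> $ \<xi> t) *v z_at M t) $ j)
           - column (\<xi> (Suc t)) (fst \<theta> $ \<xi> t) \<bullet> z_at M t)))"
    using pos by (simp add: joint_density_def obs_density_def transition_prob_def G_at_def softmax_eq_exp
        transpose_mult_nth exp_diff exp_minus divide_simps del: transpose_matrix_vector)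
  also have "\<dots> = exp (ln (p_init M (\<xi> 0) (z_init M)) +
      (\<Sum>t<horizon M. ln (obs_const M) - f_fun M (G_at M t (snd \<theta> $ \<xi> (Suc t)))
        - (lse UNIV (\<lambda>j. (transpose (fst \<theta> $ \<xi> t) *v z_at M t) $ j)
           - column (\<xi> (Suc t)) (fst \<theta> $ \<xi> t) \<bullet> z_at M t)))"
    using pos by (simp add: exp_add exp_sum del: transpose_matrix_vector)
  also have "\<dots> = exp (log_const M \<xi> - (Psi M (fst \<theta>) \<xi> + Phi M (snd \<theta>) \<xi>))"
    by (simp add: log_const_def Psi_def Phi_def sum_subtractf sum.distrib algebra_simps del: transpose_matrix_vector)
  finally show ?thesis .
qed

lemma evidence_pos: "(\<Sum>\<xi>\<in>mode_paths M. joint_density M \<theta> \<xi>) > 0"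
  by (intro sum_pos) (auto simp: joint_density_eq)

lemma posterior_nonneg: "posterior M \<theta> \<xi> \<ge> 0"
  using evidence_pos[of \<theta>] by (simp add: posterior_def joint_density_eq[of \<theta> \<xi>])

lemma sum_posterior: "(\<Sum>\<xi>\<in>mode_paths M. posterior M \<theta> \<xi>) = 1"
  using evidence_pos[of \<theta>] by (simp add: posterior_def flip: sum_divide_distrib)

subsection \<open>Convexity and continuity of the model functions\<close>

text \<open>Convexity of the components of \<open>G\<close> makes them continuous and right-differentiable, as they
  live on an open domain.\<close>

lemma convex_G: "convex_on (beta_dom M) (\<lambda>b. G_at M t b $ i)"
proof -
  let ?a = "A i (obs M (int (Suc t))) (z_at M t)"
  obtain L c where L: "linear L" "?a = (\<lambda>b. L b + c)"
    using sub unfolding subsystem_assumption_def affine_map_def by blast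
  have G: "L b + c \<in> D i \<and> G_at M t b $ i = g i (L b + c)" if "b \<in> beta_dom M" for b
    using sub that fun_cong[OF L(2), of b] unfolding subsystem_assumption_def G_at_def by metis
  have "convex_on (beta_dom M) (\<lambda>b. g i (L b + c))"
    using wf sub L G
    by (intro convex_on_affine_comp[where S = "D i"])
      (auto simp: well_formed_model_def subsystem_assumption_def)
  then show ?thesis
    using G by (simp add: convex_on_def convex_def)
qed

lemma f_GDERIV: "x \<in> f_dom M \<Longrightarrow> GDERIV (f_fun M) x :> grad (f_fun M) x"
  using sub by (auto simp: subsystem_assumption_def intro: GDERIV_grad)

lemma continuous_G: "continuous_on (beta_dom M) (G_at M t)"
proof -
  have "continuous_on (beta_dom M) (\<lambda>b. \<chi> i. G_at M t b $ i)"
    using wf by (intro continuous_on_vec_lambda convex_on_continuous convex_G)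
      (simp add: well_formed_model_def)
  then show ?thesis by simp
qed

lemma continuous_f: "continuous_on (f_dom M) (f_fun M)"
  by (meson continuous_at_imp_continuous_on f_GDERIV gderiv_def has_derivative_continuous)

lemma continuous_G_param: "continuous_on (param_dom M) (\<lambda>\<theta>. G_at M t (snd \<theta> $ j))"
  by (rule continuous_on_compose2[OF continuous_G])
    (auto intro!: continuous_intros simp: param_dom_def betas_dom_def)

lemma continuous_fG_param: "continuous_on (param_dom M) (\<lambda>\<theta>. f_fun M (G_at M t (snd \<theta> $ j)))"
  by (rule continuous_on_compose2[OF continuous_f continuous_G_param])
    (auto intro: G_at_in simp: param_dom_def betas_dom_def)

lemma continuous_grad_param:
  "continuous_on (param_dom M) (\<lambda>\<theta>. grad (f_fun M) (G_at M t (snd \<theta> $ j)))"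
proof (rule continuous_on_compose2[OF _ continuous_G_param])
  show "continuous_on (f_dom M) (grad (f_fun M))"
    using sub by (simp add: subsystem_assumption_def)
qed (auto intro: G_at_in simp: param_dom_def betas_dom_def)

lemma continuous_Psi: "continuous_on S (\<lambda>\<theta>. Psi M (fst \<theta>) \<xi>)"
proof -
  have [continuous_intros]: "continuous_on S (\<lambda>\<theta>. column j (fst \<theta> $ i))" for i j
    unfolding column_def by (intro continuous_intros)
  have "(\<Sum>j\<in>UNIV. exp (x j)) \<noteq> 0" for x :: "'d \<Rightarrow> real"
    using sum_pos[of UNIV "\<lambda>j. exp (x j)"] by simp
  then show ?thesis
    unfolding Psi_def lse_def transpose_mult_nth by (intro continuous_intros) auto
qed

lemma continuous_Phi: "continuous_on (param_dom M) (\<lambda>\<theta>. Phi M (snd \<theta>) \<xi>)"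
  unfolding Phi_def by (intro continuous_intros continuous_fG_param)

lemma continuous_joint: "continuous_on (param_dom M) (\<lambda>\<theta>. joint_density M \<theta> \<xi>)"
  unfolding joint_density_eq by (intro continuous_intros continuous_Psi continuous_Phi)

lemma continuous_posterior: "continuous_on (param_dom M) (\<lambda>\<theta>. posterior M \<theta> \<xi>)"
  unfolding posterior_def using evidence_pos
  by (intro continuous_intros continuous_joint) (auto simp: less_imp_neq[symmetric])

lemma convex_R1_proj: "convex_on UNIV (\<lambda>\<Theta>. R1 (Theta_proj \<Theta>))"
proof -
  have "convex_on Theta_space R1"
    using reg by (simp add: regularizer_assumption_def)
  from convex_on_affine_comp[OF this convex_UNIV linear_Theta_proj, of 0] show ?thesis
    by (simp add: Theta_proj_in)
qed

lemma convex_R2: "convex_on (betas_dom M) R2"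
  using reg by (simp add: regularizer_assumption_def)

lemma continuous_R: "continuous_on (param_dom M) (\<lambda>\<theta>. R1 (fst \<theta>) + R2 (snd \<theta>))"
proof (intro continuous_intros)
  have "continuous_on (param_dom M) (\<lambda>\<theta>. R1 (Theta_proj (fst \<theta>)))"
    by (rule continuous_on_compose2[OF convex_on_continuous[OF open_UNIV convex_R1_proj]])
      (auto intro: continuous_intros)
  then show "continuous_on (param_dom M) (\<lambda>\<theta>. R1 (fst \<theta>))"
    by (rule continuous_on_eq) (simp add: Theta_proj_id param_domD)
  show "continuous_on (param_dom M) (\<lambda>\<theta>. R2 (snd \<theta>))"
    by (rule continuous_on_compose2[OF convex_on_continuous[OF open_betas convex_R2]])
      (auto intro: continuous_intros param_domD)
qed

lemma continuous_loss: "continuous_on (param_dom M) (split_loss M R1 R2)"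
  unfolding split_loss_def[abs_def] neg_log_lik_def using evidence_pos
  by (intro continuous_on_add continuous_R continuous_intros continuous_joint)
    (auto simp: less_imp_neq[symmetric])

text \<open>Continuity in the anchor \<open>\<theta>'\<close> of the surrogate is where continuity of the gradient of \<open>f\<close>
  is used.\<close>

lemma continuous_surrogate_anchor:
  "continuous_on (param_dom M) (\<lambda>\<theta>'. surrogate M R1 R2 \<theta>' \<theta>)"
  unfolding surrogate_def Q1_def Q2_def Phi_hat_def
  by (intro continuous_intros continuous_posterior continuous_fG_param continuous_grad_param
      continuous_G_param)

lemma continuous_surrogate_diag:
  "continuous_on (param_dom M) (\<lambda>\<theta>. surrogate M R1 R2 \<theta> \<theta>)"
proof -
  have "continuous_on (param_dom M) (\<lambda>\<theta>. (Q1 M \<theta> (fst \<theta>) + Q2 M \<theta> (snd \<theta>)) + (R1 (fst \<theta>) + R2 (snd \<theta>)))"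
    unfolding Q1_def Q2_def Phi_hat_def
    by (intro continuous_on_add[OF _ continuous_R])
      (intro continuous_intros continuous_posterior continuous_fG_param continuous_grad_param
        continuous_G_param continuous_Psi)
  then show ?thesis by (simp add: surrogate_def algebra_simps)
qed

subsection \<open>The surrogate majorizes the loss\<close>

lemma Phi_hat_anchor: "Phi_hat M \<beta> \<beta> \<xi> = Phi M \<beta> \<xi>"
  by (simp add: Phi_hat_def Phi_def)

lemma Phi_le_Phi_hat:
  assumes "\<beta>' \<in> betas_dom M" "\<beta> \<in> betas_dom M"
  shows "Phi M \<beta> \<xi> \<le> Phi_hat M \<beta>' \<beta> \<xi>"
  unfolding Phi_def Phi_hat_def
proof (rule sum_mono, rule concave_on_le_tangent)
  show "concave_on (f_dom M) (f_fun M)"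
    using sub by (simp add: subsystem_assumption_def)
qed (use assms in \<open>auto intro!: G_at_in f_GDERIV betas_domD\<close>)

text \<open>The quotient of the evidences at \<open>\<theta>\<close> and \<open>\<theta>'\<close> is the average of the density quotients under
  the posterior at \<open>\<theta>'\<close>, to which Jensen's inequality applies.\<close>

lemma neg_log_lik_diff_le:
  "neg_log_lik M \<theta> - neg_log_lik M \<theta>' \<le> (\<Sum>\<xi>\<in>mode_paths M. posterior M \<theta>' \<xi> *
     ((Psi M (fst \<theta>) \<xi> + Phi M (snd \<theta>) \<xi>) - (Psi M (fst \<theta>') \<xi> + Phi M (snd \<theta>') \<xi>)))"
proof -
  let ?E = "\<lambda>\<theta> \<xi>. Psi M (fst \<theta>) \<xi> + Phi M (snd \<theta>) \<xi>"
  let ?Z = "\<lambda>\<theta>. \<Sum>\<xi>\<in>mode_paths M. joint_density M \<theta> \<xi>"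
  have "posterior M \<theta>' \<xi> * exp (?E \<theta>' \<xi> - ?E \<theta> \<xi>) = joint_density M \<theta> \<xi> / ?Z \<theta>'" for \<xi>
    by (simp add: posterior_def joint_density_eq[of _ \<xi>] flip: exp_add)
  then have "(\<Sum>\<xi>\<in>mode_paths M. posterior M \<theta>' \<xi> * exp (?E \<theta>' \<xi> - ?E \<theta> \<xi>)) = ?Z \<theta> / ?Z \<theta>'"
    by (simp add: sum_divide_distrib)
  then have "(\<Sum>\<xi>\<in>mode_paths M. posterior M \<theta>' \<xi> * (?E \<theta>' \<xi> - ?E \<theta> \<xi>)) \<le> ln (?Z \<theta> / ?Z \<theta>')"
    using average_le_ln_average_exp[of "mode_paths M" "posterior M \<theta>'" "\<lambda>\<xi>. ?E \<theta>' \<xi> - ?E \<theta> \<xi>"]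
    by (simp add: posterior_nonneg sum_posterior)
  also have "\<dots> = neg_log_lik M \<theta>' - neg_log_lik M \<theta>"
    using evidence_pos by (simp add: neg_log_lik_def ln_div less_imp_neq[symmetric])
  finally show ?thesis
    by (simp add: right_diff_distrib sum_subtractf)
qed

lemma loss_diff_le_surrogate_diff:
  assumes "\<theta>' \<in> param_dom M" "\<theta> \<in> param_dom M"
  shows "split_loss M R1 R2 \<theta> - split_loss M R1 R2 \<theta>'
    \<le> surrogate M R1 R2 \<theta>' \<theta> - surrogate M R1 R2 \<theta>' \<theta>'"
proof -
  have "(\<Sum>\<xi>\<in>mode_paths M. posterior M \<theta>' \<xi> *
      ((Psi M (fst \<theta>) \<xi> + Phi M (snd \<theta>) \<xi>) - (Psi M (fst \<theta>') \<xi> + Phi M (snd \<theta>') \<xi>)))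
    \<le> (\<Sum>\<xi>\<in>mode_paths M. posterior M \<theta>' \<xi> *
      ((Psi M (fst \<theta>) \<xi> + Phi_hat M (snd \<theta>') (snd \<theta>) \<xi>)
        - (Psi M (fst \<theta>') \<xi> + Phi_hat M (snd \<theta>') (snd \<theta>') \<xi>)))"
    unfolding Phi_hat_anchor using assms
    by (intro sum_mono mult_left_mono posterior_nonneg) (simp add: Phi_le_Phi_hat param_domD)
  also have "\<dots> = (Q1 M \<theta>' (fst \<theta>) + Q2 M \<theta>' (snd \<theta>)) - (Q1 M \<theta>' (fst \<theta>') + Q2 M \<theta>' (snd \<theta>'))"
    by (simp add: Q1_def Q2_def right_diff_distrib distrib_left sum_subtractf sum.distrib)
  finally show ?thesis
    using neg_log_lik_diff_le[of \<theta> \<theta>'] by (simp add: split_loss_def surrogate_def)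
qed

subsection \<open>The surrogate and the loss have the same directional derivatives at the anchor\<close>

lemma Psi_right_derivative:
  "\<exists>p. ((\<lambda>l. Psi M (\<Theta> + l *\<^sub>R V) \<xi>) has_real_derivative p) (at_right 0)"
proof -
  let ?step = "\<lambda>i k z l. lse UNIV (\<lambda>j. column j (\<Theta> $ i) \<bullet> z + l * (column j (V $ i) \<bullet> z))
      - (column k (\<Theta> $ i) \<bullet> z + l * (column k (V $ i) \<bullet> z))"
  have step: "\<exists>p. (?step i k z has_real_derivative p) (at_right 0)" for i k z
  proof -
    let ?h = "\<lambda>j l. - (column j (\<Theta> $ i) \<bullet> z + l * (column j (V $ i) \<bullet> z))"
    have h: "(?h j has_real_derivative - (column j (V $ i) \<bullet> z)) (at_right 0)" for j
      by (auto intro!: derivative_eq_intros)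
    obtain q where "((\<lambda>l. - ln (\<Sum>j\<in>UNIV. exp (0 - ?h j l))) has_real_derivative q) (at_right 0)"
      using neg_lse_has_derivative[where h = ?h and c = "\<lambda>_. 0", OF finite UNIV_not_empty h] by blast
    from DERIV_add[OF DERIV_minus[OF this] h[of k]] show ?thesis
      unfolding lse_def by (intro exI) (simp add: algebra_simps)
  qed
  have "\<forall>t. \<exists>p. (?step (\<xi> t) (\<xi> (Suc t)) (z_at M t) has_real_derivative p) (at_right 0)"
    by (intro allI step)
  from choice[OF this] obtain p
    where "\<forall>t. (?step (\<xi> t) (\<xi> (Suc t)) (z_at M t) has_real_derivative p t) (at_right 0)" ..
  then have "((\<lambda>l. \<Sum>t<horizon M. ?step (\<xi> t) (\<xi> (Suc t)) (z_at M t) l) has_real_derivative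
      (\<Sum>t<horizon M. p t)) (at_right 0)"
    by (intro DERIV_sum) blast
  then show ?thesis
    unfolding Psi_def transpose_mult_nth column_line by blast
qed

lemma G_right_derivative:
  assumes "b \<in> beta_dom M"
  shows "\<exists>p. ((\<lambda>l. G_at M t (b + l *\<^sub>R w)) has_vector_derivative p) (at_right 0)"
proof -
  have "\<exists>D. ((\<lambda>l. G_at M t (b + l *\<^sub>R w) $ i) has_real_derivative D) (at_right 0)" for i
    using wf assms by (intro convex_on_right_derivative[OF _ convex_G]) (auto simp: well_formed_model_def)
  then obtain p where "((\<lambda>l. G_at M t (b + l *\<^sub>R w) $ i) has_real_derivative p i) (at_right 0)" for i
    by metis
  then have "((\<lambda>l. G_at M t (b + l *\<^sub>R w)) has_vector_derivative (\<chi> i. p i)) (at_right 0)"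
    by (rule has_vector_derivative_vec)
  then show ?thesis by blast
qed

text \<open>Linearizing \<open>f\<close> but keeping the nonsmooth \<open>G\<close> does not change the first-order behaviour at
  the anchor: by the chain rule both derivatives pair the gradient of \<open>f\<close> with the one-sided
  derivative of \<open>G\<close>.\<close>

lemma Phi_right_derivative:
  assumes \<beta>: "\<beta> \<in> betas_dom M"
  shows "\<exists>q. ((\<lambda>l. Phi M (\<beta> + l *\<^sub>R w) \<xi>) has_real_derivative q) (at_right 0) \<and>
             ((\<lambda>l. Phi_hat M \<beta> (\<beta> + l *\<^sub>R w) \<xi>) has_real_derivative q) (at_right 0)"
proof -
  let ?G = "\<lambda>t j l. G_at M t (\<beta> $ j + l *\<^sub>R w $ j)"
  define p where "p t j = (SOME p. (?G t j has_vector_derivative p) (at_right 0))" for t j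
  have p: "(?G t j has_vector_derivative p t j) (at_right 0)" for t j
    unfolding p_def by (rule someI_ex, rule G_right_derivative, rule betas_domD, rule \<beta>)
  let ?d = "\<lambda>t j. grad (f_fun M) (G_at M t (\<beta> $ j))"
  have 1: "((\<lambda>l. f_fun M (?G t j l)) has_real_derivative ?d t j \<bullet> p t j) (at_right 0)" for t j
    by (rule GDERIV_chain_right[OF _ p]) (simp add: f_GDERIV G_at_in betas_domD \<beta>)
  have 2: "((\<lambda>l. f_fun M (G_at M t (\<beta> $ j)) + ?d t j \<bullet> (?G t j l - G_at M t (\<beta> $ j)))
      has_real_derivative ?d t j \<bullet> p t j) (at_right 0)" for t j
  proof -
    have "((\<lambda>l. ?d t j \<bullet> (?G t j l - G_at M t (\<beta> $ j))) has_vector_derivative ?d t j \<bullet> (p t j - 0)) (at_right 0)"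
      by (intro bounded_linear.has_vector_derivative[OF bounded_linear_inner_right]
          has_vector_derivative_diff p has_vector_derivative_const)
    then have "((\<lambda>l. ?d t j \<bullet> (?G t j l - G_at M t (\<beta> $ j))) has_real_derivative ?d t j \<bullet> p t j) (at_right 0)"
      by (simp add: has_real_derivative_iff_has_vector_derivative)
    from DERIV_add[OF DERIV_const this] show ?thesis by simp
  qed
  show ?thesis
    unfolding Phi_def Phi_hat_def
    by (rule exI[of _ "\<Sum>t<horizon M. ?d t (\<xi> (Suc t)) \<bullet> p t (\<xi> (Suc t))"])
      (auto intro!: DERIV_sum 1 2)
qed

lemma loss_surrogate_right_derivative:
  assumes \<theta>: "\<theta> \<in> param_dom M" and v: "v \<in> param_space"
  shows "\<exists>d. ((\<lambda>l. split_loss M R1 R2 (\<theta> + l *\<^sub>R v)) has_real_derivative d) (at_right 0) \<and>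
             ((\<lambda>l. surrogate M R1 R2 \<theta> (\<theta> + l *\<^sub>R v)) has_real_derivative d) (at_right 0)"
proof -
  let ?\<Psi> = "\<lambda>\<xi> l. Psi M (fst \<theta> + l *\<^sub>R fst v) \<xi>"
  let ?\<Phi> = "\<lambda>\<xi> l. Phi M (snd \<theta> + l *\<^sub>R snd v) \<xi>"
  let ?\<Phi>h = "\<lambda>\<xi> l. Phi_hat M (snd \<theta>) (snd \<theta> + l *\<^sub>R snd v) \<xi>"
  define p where "p \<xi> = (SOME p. (?\<Psi> \<xi> has_real_derivative p) (at_right 0))" for \<xi>
  have p: "(?\<Psi> \<xi> has_real_derivative p \<xi>) (at_right 0)" for \<xi>
    unfolding p_def by (rule someI_ex, rule Psi_right_derivative)
  define q where "q \<xi> = (SOME q. (?\<Phi> \<xi> has_real_derivative q) (at_right 0) \<and>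
      (?\<Phi>h \<xi> has_real_derivative q) (at_right 0))" for \<xi>
  have "(?\<Phi> \<xi> has_real_derivative q \<xi>) (at_right 0) \<and>
      (?\<Phi>h \<xi> has_real_derivative q \<xi>) (at_right 0)" for \<xi>
    unfolding q_def by (rule someI_ex, rule Phi_right_derivative[OF param_domD(2)[OF \<theta>]])
  then have q: "(?\<Phi> \<xi> has_real_derivative q \<xi>) (at_right 0)"
      "(?\<Phi>h \<xi> has_real_derivative q \<xi>) (at_right 0)" for \<xi>
    by auto
  let ?\<pi> = "posterior M \<theta>"
  have "((\<lambda>l. - ln (\<Sum>\<xi>\<in>mode_paths M. exp (log_const M \<xi> -
        (Psi M (fst \<theta> + l *\<^sub>R fst v) \<xi> + Phi M (snd \<theta> + l *\<^sub>R snd v) \<xi>))))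
      has_real_derivative (\<Sum>\<xi>\<in>mode_paths M. exp (log_const M \<xi> -
        (Psi M (fst \<theta> + 0 *\<^sub>R fst v) \<xi> + Phi M (snd \<theta> + 0 *\<^sub>R snd v) \<xi>)) /
        (\<Sum>\<xi>\<in>mode_paths M. exp (log_const M \<xi> -
        (Psi M (fst \<theta> + 0 *\<^sub>R fst v) \<xi> + Phi M (snd \<theta> + 0 *\<^sub>R snd v) \<xi>))) * (p \<xi> + q \<xi>))) (at_right 0)"
    by (intro neg_lse_has_derivative DERIV_add p q) auto
  then have L: "((\<lambda>l. neg_log_lik M (\<theta> + l *\<^sub>R v)) has_real_derivative
      (\<Sum>\<xi>\<in>mode_paths M. ?\<pi> \<xi> * (p \<xi> + q \<xi>))) (at_right 0)"
    by (simp add: neg_log_lik_def posterior_def joint_density_eq)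
  have Q: "((\<lambda>l. Q1 M \<theta> (fst \<theta> + l *\<^sub>R fst v) + Q2 M \<theta> (snd \<theta> + l *\<^sub>R snd v)) has_real_derivative
      (\<Sum>\<xi>\<in>mode_paths M. ?\<pi> \<xi> * p \<xi>) + (\<Sum>\<xi>\<in>mode_paths M. ?\<pi> \<xi> * q \<xi>)) (at_right 0)"
    unfolding Q1_def Q2_def by (intro DERIV_add DERIV_sum DERIV_cmult p q)
  obtain r1 where "((\<lambda>l. R1 (Theta_proj (fst \<theta> + l *\<^sub>R fst v))) has_real_derivative r1) (at_right 0)"
    using convex_on_right_derivative[OF open_UNIV convex_R1_proj] by blast
  moreover have "Theta_proj (fst \<theta> + l *\<^sub>R fst v) = fst \<theta> + l *\<^sub>R fst v" for l
    using \<theta> v by (intro Theta_proj_id Theta_space_line) (auto simp: param_domD param_space_def)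
  ultimately have r1: "((\<lambda>l. R1 (fst \<theta> + l *\<^sub>R fst v)) has_real_derivative r1) (at_right 0)"
    by simp
  obtain r2 where r2: "((\<lambda>l. R2 (snd \<theta> + l *\<^sub>R snd v)) has_real_derivative r2) (at_right 0)"
    using convex_on_right_derivative[OF open_betas convex_R2 param_domD(2)[OF \<theta>]] by blast
  note R = DERIV_add[OF r1 r2]
  have "((\<lambda>l. surrogate M R1 R2 \<theta> (\<theta> + l *\<^sub>R v)) has_real_derivative
      (\<Sum>\<xi>\<in>mode_paths M. ?\<pi> \<xi> * (p \<xi> + q \<xi>)) + (r1 + r2)) (at_right 0)"
    using DERIV_add[OF Q R] by (simp add: surrogate_def distrib_left sum.distrib algebra_simps)
  moreover have "((\<lambda>l. split_loss M R1 R2 (\<theta> + l *\<^sub>R v)) has_real_derivative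
      (\<Sum>\<xi>\<in>mode_paths M. ?\<pi> \<xi> * (p \<xi> + q \<xi>)) + (r1 + r2)) (at_right 0)"
    using DERIV_add[OF L R] by (simp add: split_loss_def)
  ultimately show ?thesis by blast
qed

lemma eventually_line_in_param_dom:
  assumes \<theta>: "\<theta> \<in> param_dom M" and v: "v \<in> param_space"
  shows "\<forall>\<^sub>F l in at_right 0. \<theta> + l *\<^sub>R v \<in> param_dom M"
proof -
  have "((\<lambda>l. snd \<theta> + l *\<^sub>R snd v) \<longlongrightarrow> snd \<theta> + 0 *\<^sub>R snd v) (at_right 0)"
    by (intro tendsto_intros)
  then have "\<forall>\<^sub>F l in at_right 0. snd \<theta> + l *\<^sub>R snd v \<in> betas_dom M"
    using open_betas param_domD(2)[OF \<theta>] by (intro topological_tendstoD) auto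
  then show ?thesis
    by eventually_elim
      (use \<theta> v in \<open>auto simp: param_dom_def param_space_def mem_Times_iff intro: Theta_space_line\<close>)
qed

text \<open>The surrogate at its own minimizer has nonnegative right derivatives, and these are the right
  derivatives of the loss.\<close>

lemma stationary_if_minimizes_own_surrogate:
  assumes \<theta>: "\<theta> \<in> param_dom M"
    and min: "\<And>x. x \<in> param_dom M \<Longrightarrow> surrogate M R1 R2 \<theta> \<theta> \<le> surrogate M R1 R2 \<theta> x"
  shows "stationary_point param_space (reg_loss M R) \<theta>"
  unfolding stationary_point_def
proof
  fix v :: "('d, 'nz, 'b) param"
  assume v: "v \<in> param_space"
  let ?q = "\<lambda>F l. (F (\<theta> + l *\<^sub>R v) - F \<theta>) / l"
  obtain d where "((\<lambda>l. split_loss M R1 R2 (\<theta> + l *\<^sub>R v)) has_real_derivative d) (at_right 0)"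
      "((\<lambda>l. surrogate M R1 R2 \<theta> (\<theta> + l *\<^sub>R v)) has_real_derivative d) (at_right 0)"
    using loss_surrogate_right_derivative[OF \<theta> v] by blast
  then have L: "(?q (split_loss M R1 R2) \<longlongrightarrow> d) (at_right 0)"
    and S: "(?q (surrogate M R1 R2 \<theta>) \<longlongrightarrow> d) (at_right 0)"
    by (simp_all add: has_field_derivative_iff)
  note dom = eventually_line_in_param_dom[OF \<theta> v]
  have pos: "\<forall>\<^sub>F l::real in at_right 0. 0 < l"
    by (rule eventually_at_right_less)
  have "\<forall>\<^sub>F l in at_right 0. 0 \<le> ?q (surrogate M R1 R2 \<theta>) l"
    using dom pos by eventually_elim (simp add: min)
  with S have "0 \<le> d"
    by (intro tendsto_lowerbound) auto
  moreover have "has_dir_derivative (reg_loss M R) \<theta> v (ereal d)"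
    unfolding has_dir_derivative_def
  proof (rule Lim_transform_eventually)
    show "((\<lambda>l. ereal (?q (split_loss M R1 R2) l)) \<longlongrightarrow> ereal d) (at_right 0)"
      using L by (rule tendsto_ereal)
    show "\<forall>\<^sub>F l in at_right 0. ereal (?q (split_loss M R1 R2) l) =
        (reg_loss M R (\<theta> + l *\<^sub>R v) - reg_loss M R \<theta>) / ereal l"
      using dom pos by eventually_elim (simp add: reg_loss_eq \<theta>)
  qed
  ultimately show "\<exists>D. has_dir_derivative (reg_loss M R) \<theta> v D \<and> 0 \<le> D"
    by (intro exI[of _ "ereal d"]) simp
qed

subsection \<open>Limit points of the iterates\<close>

lemma is_minimizer_extend_inf:
  assumes "is_minimizer (extend_inf S F) x" "S \<noteq> {}"
  shows "x \<in> S" and "y \<in> S \<Longrightarrow> F x \<le> F y"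
proof -
  have le: "extend_inf S F x \<le> extend_inf S F y" for y
    using assms(1) by (simp add: is_minimizer_def is_arg_min_linorder)
  obtain s where "s \<in> S" using assms(2) by auto
  with le[of s] show x: "x \<in> S" by (auto simp: extend_inf_def split: if_splits)
  show "F x \<le> F y" if "y \<in> S" using le[of y] x that by (simp add: extend_inf_def)
qed

lemma EMpp_step:
  assumes EM: "EMpp_iterates M R1 R2 \<theta>"
  shows "\<theta> k \<in> param_dom M"
    and "x \<in> param_dom M \<Longrightarrow> surrogate M R1 R2 (\<theta> k) (\<theta> (Suc k)) \<le> surrogate M R1 R2 (\<theta> k) x"
proof -
  have ne: "Theta_space \<noteq> ({} :: ('d, 'nz) theta1 set)" "betas_dom M \<noteq> {}"
    using EM by (auto simp: EMpp_iterates_def param_dom_def)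
  have m1: "is_minimizer (extend_inf Theta_space (\<lambda>\<Theta>. Q1 M (\<theta> k) \<Theta> + R1 \<Theta>)) (fst (\<theta> (Suc k)))"
    and m2: "is_minimizer (extend_inf (betas_dom M) (\<lambda>\<beta>. Q2 M (\<theta> k) \<beta> + R2 \<beta>)) (snd (\<theta> (Suc k)))"
    for k using EM by (auto simp: EMpp_iterates_def)
  show "\<theta> k \<in> param_dom M"
  proof (cases k)
    case 0
    then show ?thesis using EM by (simp add: EMpp_iterates_def)
  next
    case (Suc n)
    then show ?thesis
      using is_minimizer_extend_inf(1)[OF m1 ne(1)] is_minimizer_extend_inf(1)[OF m2 ne(2)]
      by (simp add: param_dom_def mem_Times_iff)
  qed
  show "surrogate M R1 R2 (\<theta> k) (\<theta> (Suc k)) \<le> surrogate M R1 R2 (\<theta> k) x" if "x \<in> param_dom M"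
    unfolding surrogate_def using that
    by (intro add_mono is_minimizer_extend_inf(2)[OF m1 ne(1)] is_minimizer_extend_inf(2)[OF m2 ne(2)])
      (simp_all add: param_domD)
qed

text \<open>The successors \<open>\<theta> (Suc (r n))\<close> need not converge, so no limit of them is taken: their
  surrogate value is at most that of the fixed competitor \<open>x\<close>, and their loss is bounded below by
  that of the limit point.\<close>

lemma limit_point_minimizes_own_surrogate:
  assumes EM: "EMpp_iterates M R1 R2 \<theta>"
    and x0: "x0 \<in> param_dom M" and r: "strict_mono r" and lim: "(\<theta> \<circ> r) \<longlonglongrightarrow> x0"
    and x: "x \<in> param_dom M"
  shows "surrogate M R1 R2 x0 x0 \<le> surrogate M R1 R2 x0 x"
proof -
  let ?L = "split_loss M R1 R2" and ?S = "surrogate M R1 R2"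
  note dom = EMpp_step(1)[OF EM]
  have along: "(\<lambda>n. F (\<theta> (r n))) \<longlonglongrightarrow> F x0" if "continuous_on (param_dom M) F"
    for F :: "_ \<Rightarrow> real"
    using continuous_on_tendsto_compose[OF that lim x0] dom by simp
  have step: "?L (\<theta> (Suc k)) - ?L (\<theta> k) \<le> ?S (\<theta> k) y - ?S (\<theta> k) (\<theta> k)"
    if "y \<in> param_dom M" for k y
    using loss_diff_le_surrogate_diff[OF dom dom, of "Suc k" k] EMpp_step(2)[OF EM that, of k] by simp
  have "?L (\<theta> (Suc k)) \<le> ?L (\<theta> k)" for k
    using step[OF dom, of k k] by simp
  then have dec: "decseq (\<lambda>k. ?L (\<theta> k))"
    by (rule decseq_SucI)
  have Lr: "(\<lambda>n. ?L (\<theta> (r n))) \<longlonglongrightarrow> ?L x0"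
    by (rule along[OF continuous_loss])
  have low: "?L x0 \<le> ?L (\<theta> k)" for k
  proof (rule LIMSEQ_le_const2[OF Lr])
    show "\<exists>N. \<forall>n\<ge>N. ?L (\<theta> (r n)) \<le> ?L (\<theta> k)"
      using decseqD[OF dec] seq_suble[OF r] by (meson order_trans)
  qed
  have "(\<lambda>n. ?S (\<theta> (r n)) x - ?S (\<theta> (r n)) (\<theta> (r n))) \<longlonglongrightarrow> ?S x0 x - ?S x0 x0"
    by (intro tendsto_diff along continuous_surrogate_anchor along[OF continuous_surrogate_diag])
  moreover have "(\<lambda>n. ?L x0 - ?L (\<theta> (r n))) \<longlonglongrightarrow> ?L x0 - ?L x0"
    by (intro tendsto_diff tendsto_const Lr)
  moreover have "?L x0 - ?L (\<theta> (r n)) \<le> ?S (\<theta> (r n)) x - ?S (\<theta> (r n)) (\<theta> (r n))" for n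
    using step[OF x, of "r n"] low[of "Suc (r n)"] by simp
  ultimately have "?L x0 - ?L x0 \<le> ?S x0 x - ?S x0 x0"
    by (intro LIMSEQ_le) auto
  then show ?thesis by simp
qed

end

theorem mainTheorem1:
  fixes M :: "('d::{finite,linorder}, 'ny::finite, 'nz::finite, 'ng::finite, 'b::euclidean_space)
                switching_model"
    and D :: "'ng \<Rightarrow> 'm::euclidean_space set"
    and g :: "'ng \<Rightarrow> 'm \<Rightarrow> real"
    and A :: "'ng \<Rightarrow> real^'ny \<Rightarrow> real^'nz \<Rightarrow> 'b \<Rightarrow> 'm"
    and R :: "('d, 'nz, 'b) param \<Rightarrow> real"
    and R1 :: "('d, 'nz) theta1 \<Rightarrow> real"
    and R2 :: "('d, 'b) theta2 \<Rightarrow> real"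
    and \<theta> :: "nat \<Rightarrow> ('d, 'nz, 'b) param"
    and r :: "nat \<Rightarrow> nat"
    and \<theta>lim :: "('d, 'nz, 'b) param"
  assumes "well_formed_model M"
    and "subsystem_assumption M D g A"
    and "regularizer_assumption M R R1 R2"
    and "EMpp_iterates M R1 R2 \<theta>"
    and "\<theta>lim \<in> param_dom M"
    and "strict_mono r" and "(\<theta> \<circ> r) \<longlonglongrightarrow> \<theta>lim"
  shows "stationary_point param_space (reg_loss M R) \<theta>lim"
proof -
  interpret em_setting M D g A R R1 R2
    using assms(1-3) by unfold_locales
  show ?thesis
    using stationary_if_minimizes_own_surrogate[OF assms(5)]
      limit_point_minimizes_own_surrogate[OF assms(4-7)] by blast
qed

end
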